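(* Let $A:X\to Y$ be a compact linear operator between Hilbert spaces, let $y\in Y$, and let $\alpha_1,\alpha_2,\ldots$ be pairwise distinct positive real numbers. Let $n\ge 1$ and $k=\lfloor n/2\rfloor$, and let $$x_{\mathcal K,n}=\operatorname*{argmin}_{x\in\mathcal K^n}\|Ax-y\|,\qquad x_{\mathcal R,n}=\operatorname*{argmin}_{x\in\mathcal R^n}\|Ax-y\|,\qquad x_{\mathcal{KR},n}=\operatorname*{argmin}_{x\in\mathcal{KR}^n}\|Ax-y\|.$$ Then $$\|Ax_{\mathcal R,n}-y\|\le \|Ax_{\mathcal{KR},n}-y\|\le\|Ax_{\mathcal K,n}-y\|$$ and $$\|Ax_{\mathcal K,n}-y\|\le \prod_{i=1}^{k}\Big(\frac{\|\overline{\mathcal A}\|}{\alpha_i}+1\Big)\|Ax_{\mathcal{KR},n}-y\|\le \prod_{i=1}^{n}\Big(\frac{\|\overline{\mathcal A}\|}{\alpha_i}+1\Big)\|Ax_{\mathcal R,n}-y\|.$$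
   Context: Notation: $\mathcal A:=A^*A$, $\overline{\mathcal A}:=AA^*$, $\mathbf y:=A^*y\in X$. For $n\ge1$ define the subspaces of $X$: $\mathcal K^n:=\operatorname{span}\{\mathbf y,\mathcal A\mathbf y,\ldots,\mathcal A^{n-1}\mathbf y\}$ (Krylov space); $\mathcal R^n:=\operatorname{span}\{(\mathcal A+\alpha_1 I)^{-1}\mathbf y,\ldots,(\mathcal A+\alpha_n I)^{-1}\mathbf y\}$ (rational Krylov space); $\mathcal{KR}^{n}$ (mixed rational Krylov space): $\mathcal{KR}^{2k}:=\operatorname{span}\{\mathbf y,(\mathcal A+\alpha_1I)^{-1}\mathbf y,\mathcal A\mathbf y,(\mathcal A+\alpha_2I)^{-1}\mathbf y,\ldots,\mathcal A^{k-1}\mathbf y,(\mathcal A+\alpha_kI)^{-1}\mathbf y\}$, i.e. $\mathcal{KR}^{2k}=\mathcal K^k+\mathcal R^k$, and $\mathcal{KR}^{2k+1}:=\mathcal K^{k+1}+\mathcal R^k$ (with $\mathcal R^0=\{0\}$). Since each of these spaces is finite-dimensional and contained in the range of $A^*$, on which $A$ is injective, the minimizers exist and are unique. *)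

theory Defs
  imports "HOL-Analysis.Analysis"
begin

text \<open>
  Hilbert spaces over a scalar field that is either the reals or the complex numbers. By the
  Gelfand--Mazur theorem these two are, up to isometric isomorphism, the only fields in the class
  \<^class>\<open>real_normed_field\<close>. A Hilbert space over such a field is given here as a real Hilbert
  space (supplied by the type classes) carrying a compatible scalar multiplication. In the complex
  case \<^const>\<open>inner\<close> is the real part of the complex inner product, which is determined by it; see
  \<open>complex_inner_product\<close> below. Norm, topology and the adjoint of a linear operator do not depend
  on which of the two inner products is used; linearity and spans are taken over the scalar field.
\<close>

locale hilbert_space = vector_space scale
  for scale :: "'k::real_normed_field \<Rightarrow> 'a::{real_inner,complete_space} \<Rightarrow> 'a" +
  assumes scale_of_real: "scale (of_real r) x = r *\<^sub>R x"
    and norm_scale: "norm (scale c x) = norm c * norm x"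

lemma hilbert_space_scaleR:
  "hilbert_space (scaleR :: real \<Rightarrow> 'a::{real_inner,complete_space} \<Rightarrow> 'a)"
  by unfold_locales (auto simp: algebra_simps)

lemma hilbert_space_complex: "hilbert_space ((*) :: complex \<Rightarrow> complex \<Rightarrow> complex)"
  by unfold_locales (auto simp: algebra_simps norm_mult scaleR_conv_of_real)

lemma (in hilbert_space) inner_scale_scale: "scale c x \<bullet> scale c y = (norm c)\<^sup>2 * (x \<bullet> y)"
proof -
  have "scale c x \<bullet> scale c y
      = ((norm (scale c (x + y)))\<^sup>2 - (norm (scale c x))\<^sup>2 - (norm (scale c y))\<^sup>2) / 2"
    by (simp add: dot_norm scale_right_distrib[symmetric] del: scale_right_distrib)
  also have "\<dots> = (norm c)\<^sup>2 * (((norm (x + y))\<^sup>2 - (norm x)\<^sup>2 - (norm y)\<^sup>2) / 2)"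
    by (simp add: norm_scale power_mult_distrib right_diff_distrib)
  finally show ?thesis by (simp add: dot_norm)
qed

lemma complex_inner_product:
  fixes s :: "complex \<Rightarrow> 'a::{real_inner,complete_space} \<Rightarrow> 'a"
  assumes "hilbert_space s"
  defines "h \<equiv> \<lambda>x y. Complex (x \<bullet> y) (x \<bullet> s \<i> y)"
  shows "h (x + x') y = h x y + h x' y"
    and "h (s c x) y = c * h x y"
    and "h y x = cnj (h x y)"
    and "h x x = of_real ((norm x)\<^sup>2)"
proof -
  interpret hilbert_space s by fact
  have ii: "s \<i> (s \<i> x) = - x" for x
    using scale_of_real[of "-1" x] by simp
  have skew: "s \<i> x \<bullet> y = - (x \<bullet> s \<i> y)" for x y
    using inner_scale_scale[of \<i> x "s \<i> y"] by (simp add: ii)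
  have c: "s c x = Re c *\<^sub>R x + Im c *\<^sub>R s \<i> x"
  proof -
    have "s c x = s (of_real (Re c) + of_real (Im c) * \<i>) x"
      by (metis complex_eq mult.commute)
    then show ?thesis
      by (simp only: scale_left_distrib scale_scale[symmetric] scale_of_real)
  qed
  show "h (x + x') y = h x y + h x' y"
    by (simp add: h_def inner_add_left complex_eq_iff)
  show "h (s c x) y = c * h x y"
    using inner_scale_scale[of \<i> x y]
    by (simp add: h_def c inner_add_left complex_eq_iff skew)
  show "h y x = cnj (h x y)"
    using skew[of x y] by (simp add: h_def complex_eq_iff inner_commute)
  show "h x x = of_real ((norm x)\<^sup>2)"
    using skew[of x x] by (simp add: h_def complex_eq_iff inner_commute dot_square_norm)
qed

definition compact_operator ::
    "('a::metric_space \<Rightarrow> 'b::metric_space) \<Rightarrow> bool" where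
  "compact_operator f \<longleftrightarrow> (\<forall>S. bounded S \<longrightarrow> compact (closure (f ` S)))"

definition normal_op :: "('a::real_inner \<Rightarrow> 'b::real_inner) \<Rightarrow> 'a \<Rightarrow> 'a" where
  "normal_op A = (\<lambda>x. adjoint A (A x))"

definition normal_op_bar :: "('a::real_inner \<Rightarrow> 'b::real_inner) \<Rightarrow> 'b \<Rightarrow> 'b" where
  "normal_op_bar A = (\<lambda>v. A (adjoint A v))"

definition resolvent :: "('a::real_inner \<Rightarrow> 'b::real_inner) \<Rightarrow> real \<Rightarrow> 'a \<Rightarrow> 'a" where
  "resolvent A a = inv (\<lambda>x. normal_op A x + a *\<^sub>R x)"

definition krylov ::
    "('k::field \<Rightarrow> 'a::real_inner \<Rightarrow> 'a) \<Rightarrow> ('a \<Rightarrow> 'b::real_inner) \<Rightarrow> 'b \<Rightarrow> nat \<Rightarrow> 'a set" where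
  "krylov s A y n = module.span s {(normal_op A ^^ j) (adjoint A y) |j. j < n}"

definition rational_krylov ::
    "('k::field \<Rightarrow> 'a::real_inner \<Rightarrow> 'a) \<Rightarrow> ('a \<Rightarrow> 'b::real_inner) \<Rightarrow> (nat \<Rightarrow> real) \<Rightarrow> 'b \<Rightarrow> nat \<Rightarrow> 'a set"
  where
  "rational_krylov s A \<alpha> y n = module.span s {resolvent A (\<alpha> i) (adjoint A y) |i. 1 \<le> i \<and> i \<le> n}"

definition mixed_krylov ::
    "('k::field \<Rightarrow> 'a::real_inner \<Rightarrow> 'a) \<Rightarrow> ('a \<Rightarrow> 'b::real_inner) \<Rightarrow> (nat \<Rightarrow> real) \<Rightarrow> 'b \<Rightarrow> nat \<Rightarrow> 'a set"
  where
  "mixed_krylov s A \<alpha> y n =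
    {u + v |u v. u \<in> krylov s A y (if even n then n div 2 else n div 2 + 1)
               \<and> v \<in> rational_krylov s A \<alpha> y (n div 2)}"

definition residual_minimizer ::
    "('a::real_inner \<Rightarrow> 'b::real_inner) \<Rightarrow> 'b \<Rightarrow> 'a set \<Rightarrow> 'a" where
  "residual_minimizer A y V = arg_min_on (\<lambda>x. norm (A x - y)) V"

end

theory Submission
  imports Defs
begin

text \<open>
  Write \<open>N = A\<^sup>* A\<close> and \<open>B = A A\<^sup>*\<close>, and for \<open>j \<le> n\<close> let \<open>V\<^sub>j\<close> be the sum of the Krylov space of
  order \<open>n - j\<close> and the rational Krylov space of order \<open>j\<close>. Then \<open>V\<^sub>0\<close>, \<open>V\<^sub>k\<close> with \<open>k = n div 2\<close>, and
  \<open>V\<^sub>n\<close> are the Krylov, the mixed and the rational space. By partial fractions, the residuals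
  \<open>y - A x\<close> with \<open>x \<in> V\<^sub>j\<close> are the vectors \<open>q(B) (B/\<alpha>\<^sub>1 + I)\<^sup>-\<^sup>1 \<cdots> (B/\<alpha>\<^sub>j + I)\<^sup>-\<^sup>1 y\<close> where \<open>q\<close> is a polynomial
  of degree at most \<open>n\<close> with \<open>q(0) = 1\<close>. Hence \<open>B/\<alpha>\<^sub>j\<^sub>+\<^sub>1 + I\<close> maps the residuals of \<open>V\<^sub>j\<^sub>+\<^sub>1\<close> onto those
  of \<open>V\<^sub>j\<close>. This operator has norm at most \<open>\<parallel>B\<parallel>/\<alpha>\<^sub>j\<^sub>+\<^sub>1 + 1\<close> and its inverse is a contraction, so the
  minimal residuals satisfy
  \<open>m\<^sub>j\<^sub>+\<^sub>1 \<le> m\<^sub>j \<le> (\<parallel>B\<parallel>/\<alpha>\<^sub>j\<^sub>+\<^sub>1 + 1) m\<^sub>j\<^sub>+\<^sub>1\<close> (\<open>min_residual_step\<close>), and all four inequalities follow by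
  iteration.

  The two mapping properties are proved on the spanning vectors, without polynomials: \<open>N + \<alpha>\<^sub>j\<^sub>+\<^sub>1\<close>
  maps \<open>V\<^sub>j\<^sub>+\<^sub>1\<close> into \<open>V\<^sub>j\<close> (\<open>shifted_normal_op_krylov_sum\<close>), and its inverse maps \<open>V\<^sub>j\<close> into \<open>V\<^sub>j\<^sub>+\<^sub>1\<close> (\<open>resolvent_krylov_sum\<close>).

  Three facts support this. Adjoints and resolvents exist on a Hilbert space, since symmetric
  coercive forms represent every bounded functional (\<open>symmetric_form_representation\<close>). The scalar
  field of a nonzero Hilbert space is generated over the reals by at most one element
  (\<open>scalars_generated\<close>), so that finitely generated subspaces have finite real dimension. Finally,
  best approximations in such subspaces exist (\<open>best_approximation_exists\<close>).
\<close>

section \<open>Symmetric coercive forms and adjoints\<close>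

text \<open>
  The representing vector minimises the energy \<open>a \<parallel>x\<parallel>\<^sup>2 + \<parallel>A x\<parallel>\<^sup>2 - 2 f x\<close>. With \<open>A = 0\<close> this is the
  Riesz representation theorem; with \<open>f = (\<lambda>h. v \<bullet> h)\<close> it solves \<open>A\<^sup>* A x + a x = v\<close>.
\<close>

lemma symmetric_form_representation:
  fixes A :: "'a::{real_inner,complete_space} \<Rightarrow> 'b::real_inner" and f :: "'a \<Rightarrow> real"
  assumes "bounded_linear A" "bounded_linear f" "a > 0"
  shows "\<exists>x. \<forall>h. a * (x \<bullet> h) + A x \<bullet> A h = f h"
proof -
  interpret A: bounded_linear A by fact
  interpret f: bounded_linear f by fact
  define J where "J x = a * (x \<bullet> x) + A x \<bullet> A x - 2 * f x" for x
  obtain K where K: "norm (f x) \<le> norm x * K" for x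
    using f.bounded by blast
  have lower: "- (K\<^sup>2 / a) \<le> J x" for x
  proof -
    have "f x \<le> norm x * K" using K[of x] by simp
    moreover have "0 \<le> (a * norm x - K)\<^sup>2 / a" using \<open>a > 0\<close> by simp
    moreover have "(a * norm x - K)\<^sup>2 / a = a * (x \<bullet> x) - 2 * (norm x * K) + K\<^sup>2 / a"
      using \<open>a > 0\<close> by (simp add: power2_norm_eq_inner[symmetric] power2_eq_square field_simps)
    moreover have "0 \<le> A x \<bullet> A x" by simp
    ultimately show ?thesis unfolding J_def by linarith
  qed
  define m where "m = Inf (range J)"
  have bdd: "bdd_below (range J)" using lower by (intro bdd_belowI2)
  have m: "m \<le> J x" for x unfolding m_def by (intro cInf_lower bdd) auto
  have "\<exists>x. J x < m + 1 / real (Suc p)" for p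
    using cInf_lessD[of "range J" "m + 1 / real (Suc p)"] by (auto simp: m_def)
  then obtain X where X: "J (X p) < m + 1 / real (Suc p)" for p by metis
  have diff: "a * (norm (x - z))\<^sup>2 \<le> 2 * (J x - m) + 2 * (J z - m)" for x z
  proof -
    \<comment> \<open>the parallelogram identity for the quadratic part\<close>
    define w where "w = (1/2) *\<^sub>R (x + z)"
    have "2 * J x + 2 * J z - 4 * J w = a * (norm (x - z))\<^sup>2 + A (x - z) \<bullet> A (x - z)"
      unfolding J_def w_def power2_norm_eq_inner
      by (simp add: A.add A.diff A.scaleR f.add f.scaleR inner_add inner_diff inner_commute algebra_simps)
    moreover have "0 \<le> A (x - z) \<bullet> A (x - z)" by simp
    ultimately show ?thesis using m[of w] by argo
  qed
  have "Cauchy X"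
  proof (rule metric_CauchyI)
    fix e :: real assume "e > 0"
    then have "0 < a * e\<^sup>2 / 4" using \<open>a > 0\<close> by simp
    then obtain N where N: "1 / real (Suc N) < a * e\<^sup>2 / 4"
      using reals_Archimedean by (metis inverse_eq_divide)
    show "\<exists>M. \<forall>p\<ge>M. \<forall>q\<ge>M. dist (X p) (X q) < e"
    proof (intro exI allI impI)
      fix p q assume pq: "N \<le> p" "N \<le> q"
      have "1 / real (Suc p) \<le> 1 / real (Suc N)" "1 / real (Suc q) \<le> 1 / real (Suc N)"
        using pq by (auto simp: frac_le)
      then have "a * (norm (X p - X q))\<^sup>2 < a * e\<^sup>2"
        using diff[of "X p" "X q"] X[of p] X[of q] N by argo
      then have "(norm (X p - X q))\<^sup>2 < e\<^sup>2" using \<open>a > 0\<close> by simp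
      then show "dist (X p) (X q) < e"
        using \<open>e > 0\<close> by (simp add: dist_norm power2_less_imp_less)
    qed
  qed
  then obtain x where x: "X \<longlonglongrightarrow> x" using Cauchy_convergent convergent_def by blast
  have "(\<lambda>p. J (X p)) \<longlonglongrightarrow> J x"
    unfolding J_def by (intro tendsto_intros A.tendsto f.tendsto x)
  moreover have "(\<lambda>p. m + 1 / real (Suc p)) \<longlonglongrightarrow> m + 0"
    by (intro tendsto_add tendsto_const) (rule LIMSEQ_Suc[OF lim_1_over_n])
  ultimately have min: "J x \<le> m"
    using X by (intro LIMSEQ_le) (auto intro: less_imp_le)
  have "a * (x \<bullet> h) + A x \<bullet> A h = f h" for h
  proof -
    define g where "g = a * (x \<bullet> h) + A x \<bullet> A h - f h"
    define q where "q = a * (h \<bullet> h) + A h \<bullet> A h"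
    \<comment> \<open>on the line \<open>x + t h\<close> the energy changes by \<open>2 t g + t\<^sup>2 q\<close>, with minimum at \<open>- g / q\<close>; the
      summand 1 avoids a case distinction for \<open>q = 0\<close>\<close>
    define t where "t = - g / (q + 1)"
    have q: "q \<ge> 0" unfolding q_def using \<open>a > 0\<close> by simp
    have "J (x + t *\<^sub>R h) - J x = 2 * t * g + t\<^sup>2 * q"
      unfolding J_def g_def q_def
      by (simp add: A.add A.scaleR f.add f.scaleR inner_add inner_commute power2_eq_square algebra_simps)
    also have "\<dots> = - (g\<^sup>2 * (q + 2) / (q + 1)\<^sup>2)"
      using q unfolding t_def by (simp add: divide_simps power2_eq_square) algebra
    finally have "g\<^sup>2 * (q + 2) / (q + 1)\<^sup>2 \<le> 0"
      using min m[of "x + t *\<^sub>R h"] by linarith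
    then have "g = 0" using q by (simp add: divide_le_0_iff mult_le_0_iff)
    then show ?thesis by (simp add: g_def)
  qed
  then show ?thesis by blast
qed

lemma adjoint_inner:
  fixes A :: "'a::{real_inner,complete_space} \<Rightarrow> 'b::real_inner"
  assumes "bounded_linear A"
  shows "x \<bullet> adjoint A v = A x \<bullet> v"
proof -
  have "\<exists>w. \<forall>x. A x \<bullet> v = x \<bullet> w" for v
  proof -
    have "bounded_linear (\<lambda>x. A x \<bullet> v)"
      by (rule bounded_linear_inner_left_comp[OF assms])
    from symmetric_form_representation[OF bounded_linear_zero[where 'b = real] this, of 1]
    have "\<exists>w. \<forall>x. w \<bullet> x = A x \<bullet> v" by simp
    then show ?thesis by (metis inner_commute)
  qed
  then have "\<exists>A'. \<forall>x v. A x \<bullet> v = x \<bullet> A' v" by metis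
  then show ?thesis unfolding adjoint_def by (rule someI2_ex) auto
qed

lemma bounded_linear_adjoint:
  fixes A :: "'a::{real_inner,complete_space} \<Rightarrow> 'b::real_inner"
  assumes "bounded_linear A"
  shows "bounded_linear (adjoint A)"
proof -
  interpret A: bounded_linear A by fact
  note adj = adjoint_inner[OF assms]
  obtain K where K: "norm (A x) \<le> norm x * K" and "K \<ge> 0" for x
    using A.nonneg_bounded by blast
  show ?thesis
  proof (rule bounded_linear_intro)
    show "adjoint A (u + v) = adjoint A u + adjoint A v" for u v
      by (rule vector_eq_ldot[THEN iffD1]) (auto simp: adj inner_add)
    show "adjoint A (r *\<^sub>R v) = r *\<^sub>R adjoint A v" for r v
      by (rule vector_eq_ldot[THEN iffD1]) (auto simp: adj)
    show "norm (adjoint A v) \<le> norm v * K" for v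
    proof (cases "adjoint A v = 0")
      case False
      have "(norm (adjoint A v))\<^sup>2 = A (adjoint A v) \<bullet> v"
        by (simp add: power2_norm_eq_inner adj)
      also have "\<dots> \<le> norm (A (adjoint A v)) * norm v" by (rule norm_cauchy_schwarz)
      also have "\<dots> \<le> norm (adjoint A v) * K * norm v" using K by (intro mult_right_mono) auto
      finally show ?thesis using False by (simp add: power2_eq_square mult.assoc mult.commute)
    qed (simp add: \<open>K \<ge> 0\<close>)
  qed
qed

lemma compact_operator_imp_bounded_linear:
  fixes A :: "'a::real_normed_vector \<Rightarrow> 'b::real_normed_vector"
  assumes "linear A" "compact_operator A"
  shows "bounded_linear A"
proof -
  interpret A: linear A by fact
  have "bounded (A ` cball 0 1)"
    using assms(2) bounded_subset[OF compact_imp_bounded closure_subset]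
    unfolding compact_operator_def by blast
  then obtain K where K: "norm x \<le> 1 \<Longrightarrow> norm (A x) \<le> K" for x
    by (fastforce simp: bounded_iff)
  show ?thesis
  proof (rule bounded_linear_intro)
    show "norm (A x) \<le> norm x * K" for x
    proof (cases "x = 0")
      case False
      have "A x = norm x *\<^sub>R A (sgn x)"
        using False by (simp add: sgn_div_norm A.scaleR[symmetric])
      then show ?thesis using K[of "sgn x"] False by (simp add: norm_sgn mult_left_mono)
    qed (simp add: A.zero)
  qed (auto simp: A.add A.scaleR)
qed

section \<open>Best approximation in finitely generated subspaces\<close>

lemma orthogonal_projection_exists:
  fixes S :: "'a::real_inner set"
  assumes "finite S"
  shows "\<exists>p\<in>span S. \<forall>q\<in>span S. (v - p) \<bullet> q = 0"
  using assms
proof (induction S arbitrary: v)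
  case empty
  then show ?case by simp
next
  case (insert a S)
  obtain p where p: "p \<in> span S" "\<And>q. q \<in> span S \<Longrightarrow> (v - p) \<bullet> q = 0"
    using insert.IH[of v] by blast
  obtain b where b: "b \<in> span S" "\<And>q. q \<in> span S \<Longrightarrow> (a - b) \<bullet> q = 0"
    using insert.IH[of a] by blast
  \<comment> \<open>the Gram--Schmidt step; if \<open>a = b\<close> then division by zero gives \<open>c = 0\<close>\<close>
  define c where "c = ((v - p) \<bullet> (a - b)) / ((a - b) \<bullet> (a - b))"
  have c: "(v - p - c *\<^sub>R (a - b)) \<bullet> (a - b) = 0"
    by (cases "a = b") (simp_all add: c_def inner_diff_left[of "v - p"])
  have sub: "span S \<subseteq> span (insert a S)" by (rule span_mono) auto
  show ?case
  proof (intro bexI ballI)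
    show "p + c *\<^sub>R (a - b) \<in> span (insert a S)"
      using p(1) b(1) sub by (intro span_add span_scale span_diff) (auto intro: span_base)
    fix q assume "q \<in> span (insert a S)"
    then obtain t where t: "q - t *\<^sub>R a \<in> span S" by (auto simp: span_breakdown_eq)
    define q' where "q' = q - t *\<^sub>R a + t *\<^sub>R b"
    have "q' \<in> span S" unfolding q'_def using t b(1) by (intro span_add span_scale)
    then have "(v - p - c *\<^sub>R (a - b)) \<bullet> q' = 0"
      using p(2) b(2) by (simp add: inner_diff_left[of "v - p"])
    moreover have "q = q' + t *\<^sub>R (a - b)" by (simp add: q'_def algebra_simps)
    ultimately show "(v - (p + c *\<^sub>R (a - b))) \<bullet> q = 0"
      using c by (simp add: inner_add_right diff_diff_eq)
  qed
qed

lemma best_approximation_exists: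
  fixes S :: "'a::real_inner set"
  assumes "finite S"
  shows "\<exists>p\<in>span S. \<forall>q\<in>span S. norm (p - v) \<le> norm (q - v)"
proof -
  obtain p where p: "p \<in> span S" "\<And>q. q \<in> span S \<Longrightarrow> (v - p) \<bullet> q = 0"
    using orthogonal_projection_exists[OF assms] by blast
  have "norm (p - v) \<le> norm (q - v)" if "q \<in> span S" for q
  proof -
    have "orthogonal (v - p) (p - q)"
      unfolding orthogonal_def using p that by (intro p(2) span_diff)
    then have "(norm ((v - p) + (p - q)))\<^sup>2 = (norm (v - p))\<^sup>2 + (norm (p - q))\<^sup>2"
      by (rule norm_add_Pythagorean)
    then have "(norm (v - p))\<^sup>2 \<le> (norm (v - q))\<^sup>2" by simp
    then show ?thesis by (simp add: norm_minus_commute)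
  qed
  with p(1) show ?thesis by blast
qed

context hilbert_space
begin

text \<open>
  The scalar field is the reals or a quadratic extension of them. A unit vector transports the inner
  product to the field, and then every unit scalar orthogonal to 1 squares to -1.
\<close>

lemma scalars_generated:
  fixes x :: 'a
  assumes "x \<noteq> 0"
  shows "\<exists>j. \<forall>c::'k. \<exists>r t. c = of_real r + of_real t * j"
proof -
  define e where "e = sgn x"
  have e: "e \<bullet> e = 1"
    using assms by (simp add: e_def power2_norm_eq_inner[symmetric] norm_sgn)
  define ip where "ip c d = scale c e \<bullet> scale d e" for c d
  have ip_self: "ip c c = (norm c)\<^sup>2" for c by (simp add: ip_def inner_scale_scale e)
  have ip_add: "ip (c + d) b = ip c b + ip d b" and ip_diff: "ip (c - d) b = ip c b - ip d b" 
    and ip_real: "ip (of_real r * c) b = r * ip c b" for b c d r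
    by (simp_all add: ip_def scale_left_distrib scale_left_diff_distrib inner_add_left
        inner_diff_left scale_of_real flip: scale_scale)
  have ip_comm: "ip b c = ip c b" for b c by (simp add: ip_def inner_commute)
  have one: "ip 1 1 = 1" by (simp add: ip_self)
  have norm_diff: "(norm (c - d))\<^sup>2 = (norm c)\<^sup>2 + (norm d)\<^sup>2 - 2 * ip c d"
    and norm_add: "(norm (c + d))\<^sup>2 = (norm c)\<^sup>2 + (norm d)\<^sup>2 + 2 * ip c d" for c d
    using ip_comm[of c "c - d"] ip_comm[of d "c - d"] ip_comm[of c "c + d"] ip_comm[of d "c + d"]
      ip_comm[of d c]
    by (simp_all add: ip_self[symmetric] ip_add ip_diff)
  have sq: "u * u = - 1" if "ip u 1 = 0" "norm u = 1" for u
  proof -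
    \<comment> \<open>\<open>u * u\<close> and 1 are unit vectors at distance 2, hence antipodal\<close>
    have "(norm (u * u - 1))\<^sup>2 = (norm (u - 1))\<^sup>2 * (norm (u + 1))\<^sup>2"
      by (simp add: algebra_simps flip: norm_mult power_mult_distrib)
    also have "\<dots> = 4" using that by (simp add: norm_diff norm_add)
    finally have "ip (u * u) 1 = - 1" using that by (simp add: norm_diff norm_mult)
    then have "(norm (u * u + 1))\<^sup>2 = 0" using that by (simp add: norm_add norm_mult)
    then show ?thesis by (simp add: eq_neg_iff_add_eq_0)
  qed
  \<comment> \<open>the component of a scalar orthogonal to 1, and its normalisation\<close>
  define im where "im c = c - of_real (ip c 1)" for c
  have im: "ip (im c) 1 = 0" for c
    using ip_real[of "ip c 1" 1 1] by (simp add: im_def ip_diff one)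
  have c_im: "c = of_real (ip c 1) + im c" for c by (simp add: im_def)
  define dir where "dir c = of_real (1 / norm (im c)) * im c" for c
  have im_dir: "im c = of_real (norm (im c)) * dir c" for c
    by (cases "im c = 0") (simp_all add: dir_def)
  have dir: "dir c * dir c = - 1" if "im c \<noteq> 0" for c
  proof (rule sq)
    show "ip (dir c) 1 = 0" unfolding dir_def by (simp add: ip_real im del: of_real_divide)
    show "norm (dir c) = 1" using that by (simp add: dir_def norm_mult norm_divide)
  qed
  show ?thesis
  proof (cases "\<exists>d. im d \<noteq> 0")
    case False
    then show ?thesis using c_im by (metis add.right_neutral mult_zero_right)
  next
    case True
    then obtain d where d: "im d \<noteq> 0" by blast
    have "\<exists>r t. c = of_real r + of_real t * dir d" for c
    proof (cases "im c = 0")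
      case True
      then show ?thesis using c_im[of c] by (metis mult_zero_left of_real_0)
    next
      case False
      \<comment> \<open>in a field the two square roots of -1 agree up to sign\<close>
      have "(dir c - dir d) * (dir c + dir d) = 0"
        using dir[OF False] dir[OF d] by (simp add: algebra_simps)
      then have "dir c = dir d \<or> dir c = - dir d"
        by (auto simp: eq_neg_iff_add_eq_0)
      then have "im c = of_real (norm (im c)) * dir d \<or> im c = of_real (- norm (im c)) * dir d"
        using im_dir[of c] by auto
      then show ?thesis using c_im[of c] by metis
    qed
    then show ?thesis by blast
  qed
qed

lemma subspace_imp_real_subspace: "subspace V \<Longrightarrow> real_vector.subspace V"
  unfolding real_vector.subspace_def
  using subspace_0 subspace_add subspace_scale scale_of_real by metis

lemma span_eq_real_span:
  assumes "finite S"
  shows "\<exists>T. finite T \<and> span S = real_vector.span T"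
proof (cases "\<forall>x::'a. x = 0")
  case True
  then have "span S = real_vector.span {}" 
    using span_zero by auto
  then show ?thesis by blast
next
  case False
  then obtain j where j: "\<And>c::'k. \<exists>r t. c = of_real r + of_real t * j"
    using scalars_generated by blast
  let ?T = "S \<union> scale j ` S"
  have "span S = real_vector.span ?T"
  proof
    show "span S \<subseteq> real_vector.span ?T"
    proof
      fix x assume "x \<in> span S"
      then show "x \<in> real_vector.span ?T"
      proof (induction rule: span_induct_alt)
        case base
        show ?case by (rule real_vector.span_zero)
      next
        case (step c x z)
        obtain r t where c: "c = of_real r + of_real t * j" using j by blast
        have "scale c x = r *\<^sub>R x + t *\<^sub>R scale j x"
          unfolding c by (simp only: scale_left_distrib scale_scale[symmetric] scale_of_real)
        with step show ?case
          by (auto intro!: real_vector.span_add real_vector.span_scale intro: real_vector.span_base)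
      qed
    qed
    show "real_vector.span ?T \<subseteq> span S"
      by (rule real_vector.span_minimal)
        (auto intro: span_base span_scale subspace_imp_real_subspace subspace_span)
  qed
  then show ?thesis using assms by blast
qed

end


section \<open>Normal operator and resolvents\<close>

text \<open>
  A bounded operator between Hilbert spaces that is linear over the common scalar field.
\<close>

locale hilbert_operator = X: hilbert_space scaleX + Y: hilbert_space scaleY +
    A: Vector_Spaces.linear scaleX scaleY A
  for scaleX :: "'k::real_normed_field \<Rightarrow> 'x::{real_inner,complete_space} \<Rightarrow> 'x"
    and scaleY :: "'k \<Rightarrow> 'y::{real_inner,complete_space} \<Rightarrow> 'y"
    and A :: "'x \<Rightarrow> 'y" +
  assumes bounded_linear: "bounded_linear A"
begin

lemma A_scaleR: "A (r *\<^sub>R x) = r *\<^sub>R A x"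
  using A.scale[of "of_real r" x] by (simp add: X.scale_of_real Y.scale_of_real)

lemmas adj = adjoint_inner[OF bounded_linear]

sublocale adj: bounded_linear "adjoint A"
  by (rule bounded_linear_adjoint[OF bounded_linear])

text \<open>
  The adjoint is defined through the real inner product; it commutes with all scalars because
  \<open>\<lambda>x y. c x \<bullet> c y\<close> is a real multiple of the inner product.
\<close>

lemma adjoint_scale: "adjoint A (scaleY c v) = scaleX c (adjoint A v)"
proof (cases "c = 0")
  case True
  then show ?thesis by simp
next
  case False
  have "x \<bullet> adjoint A (scaleY c v) = x \<bullet> scaleX c (adjoint A v)" for x
  proof -
    define z where "z = scaleX (inverse c) x"
    have x: "x = scaleX c z" using False by (simp add: z_def)
    show ?thesis
      unfolding x by (simp add: adj A.scale X.inner_scale_scale Y.inner_scale_scale)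
  qed
  then show ?thesis by (rule vector_eq_ldot[THEN iffD1, OF allI])
qed

lemma normal_op_add: "normal_op A (x + z) = normal_op A x + normal_op A z"
  and normal_op_diff: "normal_op A (x - z) = normal_op A x - normal_op A z"
  and normal_op_scale: "normal_op A (scaleX c x) = scaleX c (normal_op A x)"
  and normal_op_scaleR: "normal_op A (r *\<^sub>R x) = r *\<^sub>R normal_op A x"
  by (simp_all add: normal_op_def A.add A.diff A.scale A_scaleR adj.add adj.diff adj.scaleR adjoint_scale)

lemma scaleX_scaleR: "scaleX c (r *\<^sub>R x) = r *\<^sub>R scaleX c x"
  by (simp flip: X.scale_of_real add: X.scale_left_commute)

lemma resolvent_ex1:
  assumes "a > 0"
  shows "\<exists>!z. normal_op A z + a *\<^sub>R z = x"
proof (rule ex_ex1I)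
  have "bounded_linear (\<lambda>h. x \<bullet> h)" by (rule bounded_linear_inner_right)
  from symmetric_form_representation[OF bounded_linear this assms]
  obtain z where z: "a * (z \<bullet> h) + A z \<bullet> A h = x \<bullet> h" for h by blast
  have "h \<bullet> (normal_op A z + a *\<^sub>R z) = h \<bullet> x" for h
    using z[of h] by (simp add: inner_add_right normal_op_def adj inner_commute)
  then show "\<exists>z. normal_op A z + a *\<^sub>R z = x" by (metis vector_eq_ldot)
next
  fix z z' assume "normal_op A z + a *\<^sub>R z = x" "normal_op A z' + a *\<^sub>R z' = x"
  moreover have "normal_op A (z - z') + a *\<^sub>R (z - z')
      = (normal_op A z + a *\<^sub>R z) - (normal_op A z' + a *\<^sub>R z')"
    by (simp add: normal_op_diff algebra_simps)
  ultimately have "normal_op A (z - z') + a *\<^sub>R (z - z') = 0" by simp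
  then have "(z - z') \<bullet> (normal_op A (z - z') + a *\<^sub>R (z - z')) = 0" by simp
  then have "A (z - z') \<bullet> A (z - z') + a * ((z - z') \<bullet> (z - z')) = 0"
    by (simp only: inner_add_right normal_op_def adj inner_scaleR_right)
  moreover have "0 \<le> A (z - z') \<bullet> A (z - z')" "0 \<le> a * ((z - z') \<bullet> (z - z'))"
    using assms by auto
  ultimately have "a * ((z - z') \<bullet> (z - z')) = 0" by linarith
  then show "z = z'" using assms by simp
qed

lemma resolvent_iff:
  assumes "a > 0"
  shows "resolvent A a x = z \<longleftrightarrow> normal_op A z + a *\<^sub>R z = x"
proof -
  have "bij (\<lambda>z. normal_op A z + a *\<^sub>R z)"
    using resolvent_ex1[OF assms] by (auto simp: bij_iff)
  then show ?thesis
    using bij_inv_eq_iff[of "\<lambda>z. normal_op A z + a *\<^sub>R z" z x]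
    unfolding resolvent_def by auto
qed

lemma resolvent_eq: "a > 0 \<Longrightarrow> normal_op A (resolvent A a x) + a *\<^sub>R resolvent A a x = x"
  using resolvent_iff by blast

lemma linear_resolvent:
  assumes "a > 0"
  shows "Vector_Spaces.linear scaleX scaleX (resolvent A a)"
proof -
  have "resolvent A a (x + z) = resolvent A a x + resolvent A a z" for x z
    using resolvent_eq[OF assms, of x] resolvent_eq[OF assms, of z]
    by (simp add: resolvent_iff assms normal_op_add algebra_simps)
  moreover have "resolvent A a (scaleX c x) = scaleX c (resolvent A a x)" for c x
    using arg_cong[OF resolvent_eq[OF assms, of x], of "scaleX c"]
    by (simp add: resolvent_iff assms normal_op_scale X.scale_right_distrib scaleX_scaleR)
  ultimately show ?thesis by unfold_locales
qed

lemma linear_shifted_normal_op: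
  "Vector_Spaces.linear scaleX scaleX (\<lambda>x. normal_op A x + a *\<^sub>R x)"
  by unfold_locales (simp_all add: normal_op_add normal_op_scale X.scale_right_distrib scaleX_scaleR algebra_simps)

lemma linear_image_span:
  assumes "Vector_Spaces.linear scaleX scaleX f" "\<And>x. x \<in> S \<Longrightarrow> f x \<in> X.span T" "x \<in> X.span S"
  shows "f x \<in> X.span T"
proof -
  interpret f: Vector_Spaces.linear scaleX scaleX f by fact
  have "f ` X.span S \<subseteq> X.span T"
    unfolding f.span_image[symmetric]
    using assms(2) by (intro X.span_minimal) auto
  then show ?thesis using assms(3) by blast
qed

lemma residual_minimizer_span:
  assumes "finite S"
  shows "residual_minimizer A y (X.span S) \<in> X.span S"
    and "z \<in> X.span S \<Longrightarrow> norm (A (residual_minimizer A y (X.span S)) - y) \<le> norm (A z - y)"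
proof -
  obtain T where T: "finite T" "Y.span (A ` S) = real_vector.span T"
    using Y.span_eq_real_span[of "A ` S"] assms by auto
  obtain x where x: "x \<in> X.span S" "\<And>z. z \<in> X.span S \<Longrightarrow> norm (A x - y) \<le> norm (A z - y)"
    using best_approximation_exists[OF T(1), of y] unfolding T(2)[symmetric] A.span_image by blast
  have min: "residual_minimizer A y (X.span S) \<in> X.span S \<and>
    (\<forall>z. z \<in> X.span S \<longrightarrow> \<not> norm (A z - y) < norm (A (residual_minimizer A y (X.span S)) - y))"
    unfolding residual_minimizer_def arg_min_on_def
  proof (rule arg_minI[where x = x])
    show "x \<in> X.span S" by (rule x(1))
    show "\<not> norm (A z - y) < norm (A x - y)" if "z \<in> X.span S" for z
      using x(2)[OF that] by simp
  qed blast
  show "residual_minimizer A y (X.span S) \<in> X.span S"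
    and "z \<in> X.span S \<Longrightarrow> norm (A (residual_minimizer A y (X.span S)) - y) \<le> norm (A z - y)"
    using min by (simp_all add: not_less)
qed

end

section \<open>Sums of Krylov and rational Krylov spaces\<close>

text \<open>
  The sum of a Krylov space of order \<open>p\<close> and a rational Krylov space of order \<open>j\<close>. All three
  kinds of space arise as special cases with \<open>p + j = n\<close>.
\<close>

definition krylov_sum ::
    "('k::field \<Rightarrow> 'a::real_inner \<Rightarrow> 'a) \<Rightarrow> ('a \<Rightarrow> 'b::real_inner) \<Rightarrow> (nat \<Rightarrow> real) \<Rightarrow> 'b \<Rightarrow> nat \<Rightarrow> nat \<Rightarrow> 'a set"
  where
  "krylov_sum s A \<alpha> y p j = module.span s
    ({(normal_op A ^^ i) (adjoint A y) |i. i < p} \<union> {resolvent A (\<alpha> i) (adjoint A y) |i. 1 \<le> i \<and> i \<le> j})"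

context hilbert_operator
begin

context
  fixes \<alpha> :: "nat \<Rightarrow> real" and y :: 'y
  assumes \<alpha>_inj: "inj_on \<alpha> {1..}" and \<alpha>_pos: "\<And>i. i \<ge> 1 \<Longrightarrow> \<alpha> i > 0"
begin

abbreviation "V \<equiv> krylov_sum scaleX A \<alpha> y"

lemma krylov_sum_power: "i < p \<Longrightarrow> (normal_op A ^^ i) (adjoint A y) \<in> V p j"
  unfolding krylov_sum_def by (rule X.span_base) blast

lemma krylov_sum_resolvent: "1 \<le> i \<Longrightarrow> i \<le> j \<Longrightarrow> resolvent A (\<alpha> i) (adjoint A y) \<in> V p j"
  unfolding krylov_sum_def by (rule X.span_base) blast

lemma krylov_sum_adjoint: "adjoint A y \<in> V (Suc p) j"
  using krylov_sum_power[of 0 "Suc p" j] by simp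

lemma real_subspace_krylov_sum: "real_vector.subspace (V p j)"
  unfolding krylov_sum_def by (intro X.subspace_imp_real_subspace X.subspace_span)

lemmas krylov_sum_add = real_vector.subspace_add[OF real_subspace_krylov_sum]
lemmas krylov_sum_diff = real_vector.subspace_diff[OF real_subspace_krylov_sum]
lemmas krylov_sum_scaleR = real_vector.subspace_scale[OF real_subspace_krylov_sum]

text \<open>
  The shift by \<open>\<alpha>\<^sub>j\<^sub>+\<^sub>1\<close> trades the last resolvent for one more power: it cancels that resolvent,
  and it turns the resolvent with parameter \<open>\<alpha>\<^sub>i\<close> into the identity plus a multiple of itself.
\<close>

lemma shifted_normal_op_krylov_sum:
  assumes "x \<in> V p (Suc j)"
  shows "normal_op A x + \<alpha> (Suc j) *\<^sub>R x \<in> V (Suc p) j"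
  unfolding krylov_sum_def
proof (rule linear_image_span[OF linear_shifted_normal_op _ assms[unfolded krylov_sum_def]],
    fold krylov_sum_def)
  let ?a = "\<alpha> (Suc j)"
  fix x
  assume "x \<in> {(normal_op A ^^ i) (adjoint A y) |i. i < p} \<union>
    {resolvent A (\<alpha> i) (adjoint A y) |i. 1 \<le> i \<and> i \<le> Suc j}"
  then consider i where "x = (normal_op A ^^ i) (adjoint A y)" "i < p"
    | i where "x = resolvent A (\<alpha> i) (adjoint A y)" "1 \<le> i" "i \<le> Suc j" by blast
  then show "normal_op A x + ?a *\<^sub>R x \<in> V (Suc p) j"
  proof cases
    case 1
    then show ?thesis
      using krylov_sum_power[of "Suc i" "Suc p"] krylov_sum_power[of i "Suc p"]
      by (auto intro!: krylov_sum_add krylov_sum_scaleR)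
  next
    case 2
    have "normal_op A x + \<alpha> i *\<^sub>R x = adjoint A y"
      using 2 resolvent_eq \<alpha>_pos by simp
    then have *: "normal_op A x + ?a *\<^sub>R x = adjoint A y + (?a - \<alpha> i) *\<^sub>R x"
      by (auto simp: algebra_simps)
    show ?thesis
    proof (cases "i = Suc j")
      case True
      then show ?thesis using * krylov_sum_adjoint by simp
    next
      case False
      then show ?thesis
        unfolding * using 2 by (auto intro!: krylov_sum_add krylov_sum_scaleR krylov_sum_adjoint krylov_sum_resolvent)
    qed
  qed
qed

text \<open>
  Conversely, the new resolvent lowers a power by one up to a multiple of the resolvent of the
  previous power, and its product with another resolvent is a linear combination of the two since
  the parameters are distinct.
\<close>

lemma resolvent_krylov_sum:
  assumes "x \<in> V (Suc p) j"
  shows "resolvent A (\<alpha> (Suc j)) x \<in> V p (Suc j)"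
  unfolding krylov_sum_def
proof (rule linear_image_span[OF linear_resolvent _ assms[unfolded krylov_sum_def]],
    fold krylov_sum_def)
  define a where "a = \<alpha> (Suc j)"
  show a: "0 < \<alpha> (Suc j)" by (rule \<alpha>_pos) simp
  fix x
  assume "x \<in> {(normal_op A ^^ i) (adjoint A y) |i. i < Suc p} \<union>
    {resolvent A (\<alpha> i) (adjoint A y) |i. 1 \<le> i \<and> i \<le> j}"
  then consider i where "x = (normal_op A ^^ i) (adjoint A y)" "i \<le> p"
    | i where "x = resolvent A (\<alpha> i) (adjoint A y)" "1 \<le> i" "i \<le> j" by auto
  then show "resolvent A (\<alpha> (Suc j)) x \<in> V p (Suc j)"
  proof cases
    case 1
    have "resolvent A a ((normal_op A ^^ i) (adjoint A y)) \<in> V p (Suc j)"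
      using 1(2)
    proof (induction i)
      case 0
      show ?case using krylov_sum_resolvent[of "Suc j"] by (simp add: a_def)
    next
      case (Suc i)
      define u where "u = (normal_op A ^^ i) (adjoint A y)"
      have "resolvent A a (normal_op A u) = u - a *\<^sub>R resolvent A a u"
      proof -
        define v where "v = resolvent A a u"
        have v: "normal_op A v = u - a *\<^sub>R v"
          using resolvent_eq[OF a, of u] by (simp add: v_def a_def eq_diff_eq)
        have "normal_op A (u - a *\<^sub>R v) + a *\<^sub>R (u - a *\<^sub>R v) = normal_op A u"
          by (simp add: normal_op_diff normal_op_scaleR v)
        then show ?thesis
          unfolding v_def[symmetric] using resolvent_iff[OF a, folded a_def] by blast
      qed
      then show ?case
        using Suc by (auto simp flip: u_def intro!: krylov_sum_diff krylov_sum_scaleR)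
          (simp add: u_def krylov_sum_power)
    qed
    then show ?thesis using 1(1) by (simp add: a_def)
  next
    case 2
    have ne: "\<alpha> i - a \<noteq> 0"
      using 2 inj_onD[OF \<alpha>_inj, of i "Suc j"] by (auto simp: a_def)
    define u where "u = adjoint A y"
    \<comment> \<open>the resolvent identity\<close>
    define d where "d = resolvent A a u - x"
    have x: "normal_op A x = u - \<alpha> i *\<^sub>R x" and r: "normal_op A (resolvent A a u) = u - a *\<^sub>R resolvent A a u"
      using 2 resolvent_eq[of "\<alpha> i" u] resolvent_eq[of a u] \<alpha>_pos[of i] a
      by (auto simp: u_def a_def eq_diff_eq)
    have "normal_op A d + a *\<^sub>R d = (\<alpha> i - a) *\<^sub>R x"
      unfolding d_def normal_op_diff x r by (simp add: algebra_simps)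
    then have "(1 / (\<alpha> i - a)) *\<^sub>R (normal_op A d + a *\<^sub>R d) = x"
      using ne by simp
    then have "resolvent A a x = (1 / (\<alpha> i - a)) *\<^sub>R d"
      unfolding resolvent_iff[OF a, folded a_def]
      by (simp add: normal_op_scaleR scaleR_add_right mult.commute)
    then show ?thesis
      using 2 unfolding d_def a_def u_def
      by (auto intro!: krylov_sum_scaleR krylov_sum_diff krylov_sum_resolvent)
  qed
qed

text \<open>
  The point \<open>z\<close> is chosen so that \<open>y - A z = (B/\<alpha>\<^sub>j\<^sub>+\<^sub>1 + I) (y - A x)\<close> with \<open>B = A A\<^sup>*\<close>.
\<close>

lemma residual_le_factor:
  assumes "x \<in> V p (Suc j)"
  shows "\<exists>z\<in>V (Suc p) j. norm (A z - y) \<le> (onorm (normal_op_bar A) / \<alpha> (Suc j) + 1) * norm (A x - y)"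
proof
  define a where "a = \<alpha> (Suc j)"
  have a: "a > 0" unfolding a_def by (rule \<alpha>_pos) simp
  define z where "z = (1 / a) *\<^sub>R (normal_op A x + a *\<^sub>R x - adjoint A y)"
  show "z \<in> V (Suc p) j"
    unfolding z_def a_def
    by (intro krylov_sum_scaleR krylov_sum_diff shifted_normal_op_krylov_sum[OF assms] krylov_sum_adjoint)
  have bl: "bounded_linear (normal_op_bar A)"
    unfolding normal_op_bar_def
    by (rule bounded_linear_compose[OF bounded_linear adj.bounded_linear_axioms])
  have "A z - y = (1 / a) *\<^sub>R normal_op_bar A (A x - y) + (A x - y)"
    using a unfolding z_def normal_op_bar_def normal_op_def
    by (simp add: A.add A.diff A_scaleR adj.diff algebra_simps)
  then have "norm (A z - y) \<le> norm ((1 / a) *\<^sub>R normal_op_bar A (A x - y)) + norm (A x - y)"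
    by (metis norm_triangle_ineq)
  also have "\<dots> \<le> (1 / a) * (onorm (normal_op_bar A) * norm (A x - y)) + norm (A x - y)"
    using a onorm[OF bl, of "A x - y"] by (simp add: divide_right_mono)
  finally show "norm (A z - y) \<le> (onorm (normal_op_bar A) / \<alpha> (Suc j) + 1) * norm (A x - y)"
    by (simp add: a_def algebra_simps)
qed

text \<open>
  Here \<open>z\<close> solves \<open>(B/\<alpha>\<^sub>j\<^sub>+\<^sub>1 + I) (y - A z) = y - A x\<close>, an equation whose solution operator is a
  contraction because \<open>B\<close> is positive semidefinite.
\<close>

lemma residual_le:
  assumes "x \<in> V (Suc p) j"
  shows "\<exists>z\<in>V p (Suc j). norm (A z - y) \<le> norm (A x - y)"
proof
  define a where "a = \<alpha> (Suc j)"
  have a: "a > 0" unfolding a_def by (rule \<alpha>_pos) simp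
  define z where "z = resolvent A a (adjoint A y + a *\<^sub>R x)"
  show "z \<in> V p (Suc j)"
    unfolding z_def a_def
    by (intro resolvent_krylov_sum krylov_sum_add krylov_sum_scaleR krylov_sum_adjoint assms)
  define w where "w = A z - y"
  have z: "normal_op A z + a *\<^sub>R z = adjoint A y + a *\<^sub>R x"
    unfolding z_def by (rule resolvent_eq[OF a])
  have "adjoint A w = a *\<^sub>R (x - z)"
    using z unfolding w_def normal_op_def by (simp add: adj.diff algebra_simps)
  then have "A (adjoint A w) = a *\<^sub>R (A x - A z)" by (simp add: A_scaleR A.diff)
  then have "a *\<^sub>R (A x - y) = a *\<^sub>R w + A (adjoint A w)"
    by (simp add: w_def algebra_simps)
  then have "a * (w \<bullet> (A x - y)) = w \<bullet> (a *\<^sub>R w + A (adjoint A w))"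
    by (metis inner_scaleR_right)
  also have "\<dots> = a * (w \<bullet> w) + adjoint A w \<bullet> adjoint A w"
    by (simp add: inner_add_right adj inner_commute)
  finally have "a * (w \<bullet> w) \<le> a * (w \<bullet> (A x - y))" by simp
  then have "(norm w)\<^sup>2 \<le> w \<bullet> (A x - y)"
    using a by (simp add: power2_norm_eq_inner)
  also have "\<dots> \<le> norm w * norm (A x - y)" by (rule norm_cauchy_schwarz)
  finally show "norm (A z - y) \<le> norm (A x - y)"
    unfolding w_def[symmetric] by (cases "w = 0") (simp_all add: power2_eq_square)
qed

text \<open>
  The smallest residual norm over the sum of the spaces of orders \<open>p\<close> and \<open>j\<close>.
\<close>

definition "min_residual p j = norm (A (residual_minimizer A y (V p j)) - y)"

lemma residual_minimizer_krylov_sum: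
  shows "residual_minimizer A y (V p j) \<in> V p j"
    and "z \<in> V p j \<Longrightarrow> min_residual p j \<le> norm (A z - y)"
proof -
  have fin: "finite ({(normal_op A ^^ i) (adjoint A y) |i. i < p} \<union>
    {resolvent A (\<alpha> i) (adjoint A y) |i. 1 \<le> i \<and> i \<le> j})"
    by (intro finite_UnI finite_image_set) auto
  show "residual_minimizer A y (V p j) \<in> V p j"
    unfolding krylov_sum_def by (rule residual_minimizer_span(1)[OF fin])
  show "z \<in> V p j \<Longrightarrow> min_residual p j \<le> norm (A z - y)"
    unfolding min_residual_def krylov_sum_def by (rule residual_minimizer_span(2)[OF fin])
qed

lemma min_residual_step:
  shows "min_residual p (Suc j) \<le> min_residual (Suc p) j"
    and "min_residual (Suc p) j \<le> (onorm (normal_op_bar A) / \<alpha> (Suc j) + 1) * min_residual p (Suc j)"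
proof -
  obtain z where "z \<in> V p (Suc j)" "norm (A z - y) \<le> min_residual (Suc p) j"
    using residual_le[OF residual_minimizer_krylov_sum(1)] unfolding min_residual_def by blast
  then show "min_residual p (Suc j) \<le> min_residual (Suc p) j"
    using residual_minimizer_krylov_sum(2) order_trans by blast
  obtain z where "z \<in> V (Suc p) j"
    "norm (A z - y) \<le> (onorm (normal_op_bar A) / \<alpha> (Suc j) + 1) * min_residual p (Suc j)"
    using residual_le_factor[OF residual_minimizer_krylov_sum(1)] unfolding min_residual_def by blast
  then show "min_residual (Suc p) j \<le> (onorm (normal_op_bar A) / \<alpha> (Suc j) + 1) * min_residual p (Suc j)"
    using residual_minimizer_krylov_sum(2) order_trans by blast
qed

lemma min_residual_antimono:
  assumes "i \<le> j" "j \<le> n"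
  shows "min_residual (n - j) j \<le> min_residual (n - i) i"
  using assms
proof (induction j rule: dec_induct)
  case (step j)
  define p where "p = n - Suc j"
  have "n - j = Suc p" using step by (simp add: p_def)
  then have "min_residual p (Suc j) \<le> min_residual (n - i) i"
    using min_residual_step(1)[of p j] step by simp
  then show ?case by (simp only: p_def)
qed simp

text \<open>
  Between \<open>j\<close> and \<open>Suc j\<close> the product gains exactly the factor by which the minimal residual may
  drop.
\<close>

lemma min_residual_prod_mono:
  defines "c \<equiv> \<lambda>i. onorm (normal_op_bar A) / \<alpha> i + 1"
  assumes "i \<le> j" "j \<le> n"
  shows "(\<Prod>l=1..i. c l) * min_residual (n - i) i \<le> (\<Prod>l=1..j. c l) * min_residual (n - j) j"
  using assms(2,3)
proof (induction j rule: dec_induct)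
  case (step j)
  have "onorm (normal_op_bar A) \<ge> 0"
    by (rule onorm_pos_le)
      (simp add: normal_op_bar_def bounded_linear_compose[OF bounded_linear adj.bounded_linear_axioms])
  then have "c l \<ge> 0" if "l \<in> {1..j}" for l
    using \<alpha>_pos[of l] that unfolding c_def by simp
  then have nonneg: "(\<Prod>l=1..j. c l) \<ge> 0" by (rule prod_nonneg)
  define p where "p = n - Suc j"
  have "n - j = Suc p" using step by (simp add: p_def)
  then have "min_residual (n - j) j \<le> c (Suc j) * min_residual (n - Suc j) (Suc j)"
    using min_residual_step(2)[of p j] by (simp add: c_def flip: p_def)
  from mult_left_mono[OF this nonneg] step show ?case by (simp add: mult.assoc)
qed simp

lemma krylov_eq: "krylov scaleX A y n = V n 0"
  unfolding krylov_def krylov_sum_def by simp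

lemma rational_krylov_eq: "rational_krylov scaleX A \<alpha> y n = V 0 n"
  unfolding rational_krylov_def krylov_sum_def by simp

lemma mixed_krylov_eq: "mixed_krylov scaleX A \<alpha> y n = V (n - n div 2) (n div 2)"
proof -
  have "(if even n then n div 2 else n div 2 + 1) = n - n div 2" by presburger
  then show ?thesis
    unfolding mixed_krylov_def krylov_def rational_krylov_def krylov_sum_def X.span_Un by simp
qed

end

end

theorem theorem1:
  fixes scaleX :: "'k::real_normed_field \<Rightarrow> 'x::{real_inner,complete_space} \<Rightarrow> 'x"
    and scaleY :: "'k \<Rightarrow> 'y::{real_inner,complete_space} \<Rightarrow> 'y"
    and A :: "'x \<Rightarrow> 'y"
    and y :: 'y
    and \<alpha> :: "nat \<Rightarrow> real"
    and n k :: nat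
    and x\<^sub>K x\<^sub>R x\<^sub>K\<^sub>R :: 'x
  assumes "hilbert_space scaleX" and "hilbert_space scaleY"
    and "Vector_Spaces.linear scaleX scaleY A"
    and "compact_operator A"
    and "inj_on \<alpha> {1..}"
    and "\<And>i. i \<ge> 1 \<Longrightarrow> \<alpha> i > 0"
    and "n \<ge> 1"
    and "k = n div 2"
    and "x\<^sub>K = residual_minimizer A y (krylov scaleX A y n)"
    and "x\<^sub>R = residual_minimizer A y (rational_krylov scaleX A \<alpha> y n)"
    and "x\<^sub>K\<^sub>R = residual_minimizer A y (mixed_krylov scaleX A \<alpha> y n)"
  shows "norm (A x\<^sub>R - y) \<le> norm (A x\<^sub>K\<^sub>R - y)
    \<and> norm (A x\<^sub>K\<^sub>R - y) \<le> norm (A x\<^sub>K - y)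
    \<and> norm (A x\<^sub>K - y) \<le> (\<Prod>i=1..k. (onorm (normal_op_bar A) / \<alpha> i + 1)) * norm (A x\<^sub>K\<^sub>R - y)
    \<and> (\<Prod>i=1..k. (onorm (normal_op_bar A) / \<alpha> i + 1)) * norm (A x\<^sub>K\<^sub>R - y)
        \<le> (\<Prod>i=1..n. (onorm (normal_op_bar A) / \<alpha> i + 1)) * norm (A x\<^sub>R - y)"
proof -
  interpret X: hilbert_space scaleX by fact
  interpret Y: hilbert_space scaleY by fact
  interpret L: Vector_Spaces.linear scaleX scaleY A by fact
  have "linear A"
    using L.add L.scale[of "of_real r" for r]
    by (intro linearI) (simp_all add: X.scale_of_real Y.scale_of_real)
  then have "bounded_linear A"
    using assms(4) by (rule compact_operator_imp_bounded_linear)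
  then interpret hilbert_operator scaleX scaleY A
    using assms(1-3) by (intro hilbert_operator.intro hilbert_operator_axioms.intro)
  note \<alpha> = assms(5,6)
  let ?m = "min_residual \<alpha> y"
  have K: "norm (A x\<^sub>K - y) = ?m (n - 0) 0" and R: "norm (A x\<^sub>R - y) = ?m (n - n) n"
    and KR: "norm (A x\<^sub>K\<^sub>R - y) = ?m (n - k) k"
    unfolding assms(8-11) by (simp_all add: min_residual_def[OF \<alpha>] krylov_eq[OF \<alpha>]
        rational_krylov_eq[OF \<alpha>] mixed_krylov_eq[OF \<alpha>])
  have k: "k \<le> n" using assms(8) by simp
  show ?thesis
    unfolding K R KR
    using min_residual_antimono[OF \<alpha>, of k n n] min_residual_antimono[OF \<alpha>, of 0 k n]
      min_residual_prod_mono[OF \<alpha>, of 0 k n] min_residual_prod_mono[OF \<alpha>, of k n n] k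
    by auto
qed

end
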